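(* Let $E$ be a real vector space and $S\colon E\to\mathbb{R}$ be sublinear. Let $Z$ be a nonempty set, let $j\colon Z\to E$ and $k\colon Z\to\mathbb{R}$ be maps and suppose that, whenever $z_1,z_2\in Z$, there exists $z\in Z$ such that $$S\big(j(z)-\tfrac12 j(z_1)-\tfrac12 j(z_2)\big)+k(z)-\tfrac12 k(z_1)-\tfrac12 k(z_2)\le 0.$$ Then there exists a linear map $L\colon E\to\mathbb{R}$ such that $L\le S$ on $E$ and $$\inf_Z\big[L\circ j+k\big]=\inf_Z\big[S\circ j+k\big].$$
   Context: All vector spaces are real. A function $S\colon E\to\mathbb{R}$ on a vector space is sublinear if $S(0)=0$, $S(\lambda x)=\lambda S(x)$ for all $x\in E$ and $\lambda>0$, and $S(x+y)\le S(x)+S(y)$ for all $x,y\in E$. Infima are taken in $[-\infty,\infty[$, i.e. the value $-\infty$ is allowed, and $\inf_Z g$ denotes $\inf_{z\in Z}g(z)$. *)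

theory Defs
  imports Complex_Main "HOL-Library.Extended_Real"
begin

definition sublinear :: "('a::real_vector \<Rightarrow> real) \<Rightarrow> bool" where
  "sublinear S \<longleftrightarrow>
     S 0 = 0 \<and>
     (\<forall>x. \<forall>c>0. S (c *\<^sub>R x) = c * S x) \<and>
     (\<forall>x y. S (x + y) \<le> S x + S y)"

end

theory Submission imports Defs begin

text \<open>
  The theorem is a Hahn--Banach statement for the pair \<open>(j, k)\<close>. After subtracting the infimum from
  \<open>k\<close> one has \<open>S (j z) + k z \<ge> 0\<close> on \<open>Z\<close>, and a linear \<open>L \<le> S\<close> with \<open>L (j z) + k z \<ge> 0\<close>
  is wanted. Every such \<open>L\<close> satisfies
  \<open>L x = L (x + c j z) - c L (j z) \<le> S (x + c j z) + c k z\<close> for \<open>c \<ge> 0\<close> and \<open>z \<in> Z\<close>, so it lies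
  below \<open>T x = Inf {S (x + c j z) + c k z | c \<ge> 0, z \<in> Z}\<close>. Conversely, \<open>T \<le> S\<close> and
  \<open>T (- j z) \<le> k z\<close>, so every linear \<open>L \<le> T\<close> is as wanted. It remains to see that \<open>T\<close> is
  sublinear and that there is a linear functional below it. If the infimum is \<open>-\<infinity>\<close>, every linear
  \<open>L \<le> S\<close> will do.

  Finiteness of \<open>T\<close> is the nonnegativity of \<open>S \<circ> j + k\<close>. Subadditivity requires that two points of
  \<open>Z\<close> with weights \<open>p\<close> and \<open>q\<close> can be replaced by a single point with weight \<open>p + q\<close>. The hypothesis
  offers this only for equal weights, but that is enough up to an arbitrarily small error: a convex
  combination is the midpoint of one of the two end points and another convex combination, so each
  use of the hypothesis halves the error (\<open>midpoint_imp_convex_approx\<close>).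

  The existence of a linear functional below a sublinear one follows from Zorn's lemma: a minimal
  sublinear functional is linear. The competitor that shows this is the functional \<open>T\<close> above for a
  one-point set \<open>Z\<close>, so the same construction (\<open>exists_sublinear_minorant\<close>) serves both purposes.
\<close>

section \<open>Sublinear functionals\<close>

lemma sublinear_zero: "sublinear S \<Longrightarrow> S 0 = 0"
  by (simp add: sublinear_def)

lemma sublinear_scale: "sublinear S \<Longrightarrow> c \<ge> 0 \<Longrightarrow> S (c *\<^sub>R x) = c * S x"
  by (cases "c = 0") (auto simp: sublinear_def)

lemma sublinear_add: "sublinear S \<Longrightarrow> S (x + y) \<le> S x + S y"
  by (simp add: sublinear_def)

lemma sublinear_minus_ge: "sublinear S \<Longrightarrow> - S (- x) \<le> S x"
  using sublinear_add[of S x "- x"] by (simp add: sublinear_zero)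

section \<open>From midpoints to convex combinations\<close>

lemma half_plus_half: "(1/2) *\<^sub>R x + (1/2) *\<^sub>R x = (x::'a::real_vector)"
  by (simp flip: scaleR_add_left)

text \<open>
  The value of \<open>(x, t) \<mapsto> S x + t\<close> at the difference of \<open>(j z, k z)\<close> and a target is the defect of
  \<open>z\<close>; the hypothesis gives defect at most \<open>0\<close> for the midpoint of two points of \<open>Z\<close>. For \<open>\<alpha> \<le> 1/2\<close> the
  target \<open>\<alpha> z1 + (1 - \<alpha>) z2\<close> is the midpoint of \<open>2\<alpha> z1 + (1 - 2\<alpha>) z2\<close> and \<open>z2\<close>; the point that the
  hypothesis assigns to an approximation of the former and to \<open>z2\<close> has at most half of that approximation's defect,
  and the case \<open>\<alpha> \<ge> 1/2\<close> is symmetric. Since this is uniform in \<open>\<alpha>\<close>, it can be iterated.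
\<close>

lemma midpoint_imp_convex_pow:
  fixes S :: "'a::real_vector \<Rightarrow> real" and j :: "'z \<Rightarrow> 'a" and k :: "'z \<Rightarrow> real"
  assumes S: "sublinear S"
    and mid: "\<And>z1 z2. z1 \<in> Z \<Longrightarrow> z2 \<in> Z \<Longrightarrow>
      \<exists>z\<in>Z. S (j z - (1/2) *\<^sub>R j z1 - (1/2) *\<^sub>R j z2) + k z - (1/2) * k z1 - (1/2) * k z2 \<le> 0"
    and z1: "z1 \<in> Z" and z2: "z2 \<in> Z"
    and \<alpha>: "0 \<le> \<alpha>" "\<alpha> \<le> 1"
  shows "\<exists>z\<in>Z. S (j z - \<alpha> *\<^sub>R j z1 - (1 - \<alpha>) *\<^sub>R j z2) + k z - \<alpha> * k z1 - (1 - \<alpha>) * k z2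
    \<le> \<bar>S (j z2 - j z1) + k z2 - k z1\<bar> / 2 ^ n"
  using \<alpha>
proof (induction n arbitrary: \<alpha>)
  case 0
  have "j z2 - \<alpha> *\<^sub>R j z1 - (1 - \<alpha>) *\<^sub>R j z2 = \<alpha> *\<^sub>R (j z2 - j z1)"
    by (simp add: algebra_simps)
  then have "S (j z2 - \<alpha> *\<^sub>R j z1 - (1 - \<alpha>) *\<^sub>R j z2) + k z2 - \<alpha> * k z1 - (1 - \<alpha>) * k z2
      = \<alpha> * (S (j z2 - j z1) + k z2 - k z1)"
    using sublinear_scale[OF S, of \<alpha> "j z2 - j z1"] 0 by (simp add: algebra_simps)
  also have "\<dots> \<le> 1 * \<bar>S (j z2 - j z1) + k z2 - k z1\<bar>"
    using 0 by (meson abs_ge_self abs_ge_zero mult_mono' order_trans mult_left_mono mult_right_mono)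
  finally show ?case using z2 by auto
next
  case (Suc n)
  let ?M = "\<bar>S (j z2 - j z1) + k z2 - k z1\<bar>"
  have halve: "\<exists>z\<in>Z. S (j z - \<alpha> *\<^sub>R j z1 - (1 - \<alpha>) *\<^sub>R j z2) + k z - \<alpha> * k z1 - (1 - \<alpha>) * k z2
      \<le> ?M / 2 ^ Suc n"
    if \<beta>: "0 \<le> \<beta>" "\<beta> \<le> 1" and e: "e \<in> Z"
      and tj: "\<alpha> *\<^sub>R j z1 + (1 - \<alpha>) *\<^sub>R j z2
        = (1/2) *\<^sub>R (\<beta> *\<^sub>R j z1 + (1 - \<beta>) *\<^sub>R j z2) + (1/2) *\<^sub>R j e"
      and tk: "\<alpha> * k z1 + (1 - \<alpha>) * k z2 = (1/2) * (\<beta> * k z1 + (1 - \<beta>) * k z2) + (1/2) * k e"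
    for \<beta> e
  proof -
    from Suc.IH[OF \<beta>] obtain w where w: "w \<in> Z"
      "S (j w - \<beta> *\<^sub>R j z1 - (1 - \<beta>) *\<^sub>R j z2) + k w - \<beta> * k z1 - (1 - \<beta>) * k z2 \<le> ?M / 2 ^ n"
      by blast
    from mid[OF w(1) e] obtain z where z: "z \<in> Z"
      "S (j z - (1/2) *\<^sub>R j w - (1/2) *\<^sub>R j e) + k z - (1/2) * k w - (1/2) * k e \<le> 0" by blast
    let ?u = "j z - (1/2) *\<^sub>R j w - (1/2) *\<^sub>R j e"
    let ?v = "j w - \<beta> *\<^sub>R j z1 - (1 - \<beta>) *\<^sub>R j z2"
    have "j z - \<alpha> *\<^sub>R j z1 - (1 - \<alpha>) *\<^sub>R j z2 = j z - (\<alpha> *\<^sub>R j z1 + (1 - \<alpha>) *\<^sub>R j z2)"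
      by (simp add: algebra_simps)
    also have "\<dots> = ?u + (1/2) *\<^sub>R ?v"
      unfolding tj by (simp add: scaleR_add_right scaleR_diff_right)
    finally have eq: "j z - \<alpha> *\<^sub>R j z1 - (1 - \<alpha>) *\<^sub>R j z2 = ?u + (1/2) *\<^sub>R ?v" .
    have "S (j z - \<alpha> *\<^sub>R j z1 - (1 - \<alpha>) *\<^sub>R j z2) \<le> S ?u + (1/2) * S ?v"
      unfolding eq
      using sublinear_add[OF S, of ?u "(1/2) *\<^sub>R ?v"] sublinear_scale[OF S, of "1/2" ?v]
      by linarith
    then have "S (j z - \<alpha> *\<^sub>R j z1 - (1 - \<alpha>) *\<^sub>R j z2) + k z - \<alpha> * k z1 - (1 - \<alpha>) * k z2
        \<le> (1/2) * (S ?v + k w - \<beta> * k z1 - (1 - \<beta>) * k z2)"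
      using z(2) tk by argo
    also have "\<dots> \<le> (1/2) * (?M / 2 ^ n)" by (rule mult_left_mono[OF w(2)]) simp
    also have "\<dots> = ?M / 2 ^ Suc n" by simp
    finally have "S (j z - \<alpha> *\<^sub>R j z1 - (1 - \<alpha>) *\<^sub>R j z2) + k z - \<alpha> * k z1 - (1 - \<alpha>) * k z2
        \<le> ?M / 2 ^ Suc n" .
    then show ?thesis using z(1) by blast
  qed
  show ?case
  proof (cases "\<alpha> \<le> 1/2")
    case True
    show ?thesis
      by (rule halve[of "2 * \<alpha>" z2]) (use Suc.prems True z2 in \<open>auto simp: algebra_simps half_plus_half\<close>)
  next
    case False
    show ?thesis
      by (rule halve[of "2 * \<alpha> - 1" z1]) (use Suc.prems False z1 in \<open>auto simp: algebra_simps half_plus_half\<close>)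
  qed
qed

corollary midpoint_imp_convex_approx:
  fixes S :: "'a::real_vector \<Rightarrow> real" and j :: "'z \<Rightarrow> 'a" and k :: "'z \<Rightarrow> real"
  assumes S: "sublinear S"
    and mid: "\<And>z1 z2. z1 \<in> Z \<Longrightarrow> z2 \<in> Z \<Longrightarrow>
      \<exists>z\<in>Z. S (j z - (1/2) *\<^sub>R j z1 - (1/2) *\<^sub>R j z2) + k z - (1/2) * k z1 - (1/2) * k z2 \<le> 0"
    and z: "z1 \<in> Z" "z2 \<in> Z" and \<alpha>: "0 \<le> \<alpha>" "\<alpha> \<le> 1" and "\<epsilon> > 0"
  shows "\<exists>z\<in>Z. S (j z - \<alpha> *\<^sub>R j z1 - (1 - \<alpha>) *\<^sub>R j z2) + k z - \<alpha> * k z1 - (1 - \<alpha>) * k z2 \<le> \<epsilon>"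
proof -
  let ?M = "\<bar>S (j z2 - j z1) + k z2 - k z1\<bar>"
  obtain n where "?M / \<epsilon> < 2 ^ n" using real_arch_pow[of 2 "?M / \<epsilon>"] by auto
  then have "?M / 2 ^ n \<le> \<epsilon>" using \<open>\<epsilon> > 0\<close> by (simp add: field_simps)
  moreover note midpoint_imp_convex_pow[OF S mid z \<alpha>, of n]
  ultimately show ?thesis by force
qed

section \<open>Sublinear minorants\<close>

text \<open>
  The witness is \<open>T x = Inf {S (x + c j z) + c k z}\<close> over \<open>c \<ge> 0\<close> and \<open>z \<in> Z\<close>, which is bounded
  below by \<open>- S (- x)\<close>. The bound \<open>T (- j z) \<le> k z\<close> comes from \<open>c = 1\<close> and is what forces
  every linear functional below \<open>T\<close> to satisfy \<open>L (j z) + k z \<ge> 0\<close>.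
\<close>

lemma exists_sublinear_minorant:
  fixes S :: "'a::real_vector \<Rightarrow> real" and j :: "'z \<Rightarrow> 'a" and k :: "'z \<Rightarrow> real"
  assumes S: "sublinear S" and ne: "Z \<noteq> {}"
    and mid: "\<And>z1 z2. z1 \<in> Z \<Longrightarrow> z2 \<in> Z \<Longrightarrow>
      \<exists>z\<in>Z. S (j z - (1/2) *\<^sub>R j z1 - (1/2) *\<^sub>R j z2) + k z - (1/2) * k z1 - (1/2) * k z2 \<le> 0"
    and pos: "\<And>z. z \<in> Z \<Longrightarrow> S (j z) + k z \<ge> 0"
  shows "\<exists>T. sublinear T \<and> (\<forall>x. T x \<le> S x) \<and> (\<forall>z\<in>Z. T (- j z) \<le> k z)"
proof -
  define g where "g x = (\<lambda>(c, z). S (x + c *\<^sub>R j z) + c * k z)" for x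
  define I where "I = {0::real..} \<times> Z"
  define T where "T x = (INF i\<in>I. g x i)" for x
  have I_ne: "I \<noteq> {}" using ne by (auto simp: I_def)
  have g_ge: "- S (- x) \<le> g x i" if "i \<in> I" for x i
  proof -
    obtain c z where i: "i = (c, z)" "c \<ge> 0" "z \<in> Z"
      using \<open>i \<in> I\<close> unfolding I_def by blast
    have "c * S (j z) = S ((x + c *\<^sub>R j z) + (- x))"
      using i by (simp add: sublinear_scale[OF S])
    also have "\<dots> \<le> S (x + c *\<^sub>R j z) + S (- x)" by (rule sublinear_add[OF S])
    finally show ?thesis
      using mult_nonneg_nonneg[OF i(2) pos[OF i(3)]] by (simp add: g_def i(1) algebra_simps)
  qed
  have bdd: "bdd_below (g x ` I)" for x using g_ge by (intro bdd_belowI2) auto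
  have T_le: "T x \<le> S (x + c *\<^sub>R j z) + c * k z" if "c \<ge> 0" "z \<in> Z" for x c z
    using cINF_lower[OF bdd, of "(c, z)" x] that by (simp add: T_def I_def g_def)
  have T_ge: "m \<le> T x" if "\<And>c z. c \<ge> 0 \<Longrightarrow> z \<in> Z \<Longrightarrow> m \<le> S (x + c *\<^sub>R j z) + c * k z" for m x
    unfolding T_def using that by (intro cINF_greatest[OF I_ne]) (auto simp: I_def g_def)
  have T_le_S: "T x \<le> S x" for x
    using ne T_le[of 0 _ x] by fastforce
  have T_0: "T 0 = 0"
    using T_le_S[of 0] g_ge[of _ 0] cINF_greatest[OF I_ne, of 0 "g 0"]
    by (simp add: T_def sublinear_zero[OF S])
  have scale_le: "T (c *\<^sub>R x) \<le> c * T x" if "c > 0" for c x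
  proof -
    have "T (c *\<^sub>R x) / c \<le> T x"
    proof (rule T_ge)
      fix d :: real and z assume d: "d \<ge> 0" and z: "z \<in> Z"
      have "T (c *\<^sub>R x) \<le> S (c *\<^sub>R x + (c * d) *\<^sub>R j z) + (c * d) * k z"
        using d \<open>c > 0\<close> by (intro T_le z) simp
      also have "\<dots> = c * (S (x + d *\<^sub>R j z) + d * k z)"
        using sublinear_scale[OF S, of c "x + d *\<^sub>R j z"] \<open>c > 0\<close> by (simp add: algebra_simps)
      finally show "T (c *\<^sub>R x) / c \<le> S (x + d *\<^sub>R j z) + d * k z"
        using \<open>c > 0\<close> by (simp add: divide_le_eq mult.commute)
    qed
    then show ?thesis using \<open>c > 0\<close> by (simp add: divide_le_eq mult.commute)
  qed
  have T_scale: "T (c *\<^sub>R x) = c * T x" if "c > 0" for c x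
  proof (rule antisym[OF scale_le[OF that]])
    have "T x \<le> (1/c) * T (c *\<^sub>R x)" using scale_le[of "1/c" "c *\<^sub>R x"] that by simp
    then show "c * T x \<le> T (c *\<^sub>R x)" using that by (simp add: field_simps)
  qed
  have merge: "T (x + y) \<le> (S (x + p *\<^sub>R j z1) + p * k z1) + (S (y + q *\<^sub>R j z2) + q * k z2)"
    if pq: "p \<ge> 0" "q \<ge> 0" and z12: "z1 \<in> Z" "z2 \<in> Z" for x y p q z1 z2
  proof -
    define s where "s = p + q"
    define \<alpha> where "\<alpha> = p / s"
    \<comment> \<open>If both weights vanish, then \<open>\<alpha> = 0\<close>, and the equations below still hold.\<close>
    have \<alpha>: "0 \<le> \<alpha>" "\<alpha> \<le> 1" using pq by (auto simp: \<alpha>_def s_def divide_le_eq)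
    have p: "p = s * \<alpha>" using pq by (auto simp: \<alpha>_def s_def)
    have q: "q = s * (1 - \<alpha>)" using p by (simp add: s_def algebra_simps)
    have s: "s \<ge> 0" using pq by (simp add: s_def)
    let ?r = "S (x + p *\<^sub>R j z1) + p * k z1 + (S (y + q *\<^sub>R j z2) + q * k z2)"
    have approx: "T (x + y) \<le> ?r + s * \<epsilon>" if "\<epsilon> > 0" for \<epsilon>
    proof -
      obtain z where z: "z \<in> Z"
        "S (j z - \<alpha> *\<^sub>R j z1 - (1 - \<alpha>) *\<^sub>R j z2) + k z - \<alpha> * k z1 - (1 - \<alpha>) * k z2 \<le> \<epsilon>"
        using midpoint_imp_convex_approx[OF S mid z12 \<alpha> \<open>\<epsilon> > 0\<close>] by blast
      let ?d = "j z - \<alpha> *\<^sub>R j z1 - (1 - \<alpha>) *\<^sub>R j z2"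
      have eq: "x + y + s *\<^sub>R j z = ((x + p *\<^sub>R j z1) + (y + q *\<^sub>R j z2)) + s *\<^sub>R ?d"
        unfolding p q by (simp add: algebra_simps)
      have "S (x + y + s *\<^sub>R j z) \<le> S (x + p *\<^sub>R j z1) + S (y + q *\<^sub>R j z2) + s * S ?d"
        unfolding eq
        using sublinear_add[OF S, of "x + p *\<^sub>R j z1" "y + q *\<^sub>R j z2"]
          sublinear_add[OF S, of "(x + p *\<^sub>R j z1) + (y + q *\<^sub>R j z2)" "s *\<^sub>R ?d"]
          sublinear_scale[OF S s, of ?d] by linarith
      moreover have "s * S ?d + s * k z \<le> p * k z1 + q * k z2 + s * \<epsilon>"
        using mult_left_mono[OF z(2) s] unfolding p q by (simp add: algebra_simps)
      ultimately show ?thesis using T_le[OF s z(1), of "x + y"] by simp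
    qed
    show ?thesis
    proof (rule field_le_epsilon)
      fix e :: real assume "e > 0"
      have "s * (e / (s + 1)) \<le> e" using s \<open>e > 0\<close> by (simp add: field_simps)
      then show "T (x + y) \<le> ?r + e" using approx[of "e / (s + 1)"] s \<open>e > 0\<close> by force
    qed
  qed
  have T_add: "T (x + y) \<le> T x + T y" for x y
  proof -
    have "T (x + y) - T y \<le> T x"
    proof (rule T_ge)
      fix p z1 assume 1: "(p::real) \<ge> 0" "z1 \<in> Z"
      have "T (x + y) - (S (x + p *\<^sub>R j z1) + p * k z1) \<le> T y"
        by (rule T_ge) (use merge[OF 1(1) _ 1(2), of _ _ x y] in \<open>simp add: diff_le_eq add.commute\<close>)
      then show "T (x + y) - T y \<le> S (x + p *\<^sub>R j z1) + p * k z1" by simp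
    qed
    then show ?thesis by simp
  qed
  have "T (- j z) \<le> k z" if "z \<in> Z" for z
    using T_le[of 1 z "- j z"] that by (simp add: sublinear_zero[OF S])
  moreover have "sublinear T" unfolding sublinear_def using T_0 T_scale T_add by auto
  ultimately show ?thesis using T_le_S by blast
qed

section \<open>Linear functionals below a sublinear one\<close>

text \<open>
  If \<open>T\<close> is minimal, the minorant obtained from the one-point family \<open>j = y\<close>, \<open>k = - T y\<close> is \<open>T\<close>
  itself, so \<open>T (- y) \<le> - T y\<close>. Thus \<open>T\<close> is odd, and an odd sublinear functional is also
  superadditive.
\<close>

lemma minimal_sublinear_imp_linear:
  fixes T :: "'a::real_vector \<Rightarrow> real"
  assumes T: "sublinear T"
    and minimal: "\<And>T'. sublinear T' \<Longrightarrow> (\<And>x. T' x \<le> T x) \<Longrightarrow> T' = T"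
  shows "linear T"
proof -
  have odd: "T (- y) = - T y" for y
  proof -
    \<comment> \<open>The midpoint hypothesis for a one-point family is \<open>T 0 \<le> 0\<close>.\<close>
    have halves: "y - (1/2) *\<^sub>R y - (1/2) *\<^sub>R y = 0"
      by (simp only: diff_diff_eq half_plus_half diff_self)
    have "\<exists>T'. sublinear T' \<and> (\<forall>x. T' x \<le> T x) \<and> (\<forall>z\<in>{()}. T' (- y) \<le> - T y)"
      by (rule exists_sublinear_minorant[OF T, where j = "\<lambda>_. y" and k = "\<lambda>_. - T y"])
        (simp_all add: halves sublinear_zero[OF T])
    then obtain T' where "sublinear T'" "\<And>x. T' x \<le> T x" "T' (- y) \<le> - T y" by auto
    with minimal[of T'] have "T (- y) \<le> - T y" by simp
    then show ?thesis using sublinear_minus_ge[OF T, of y] by simp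
  qed
  show ?thesis
  proof (rule linearI)
    fix x y
    have "T x \<le> T (x + y) + T (- y)" using sublinear_add[OF T, of "x + y" "- y"] by simp
    then show "T (x + y) = T x + T y" using sublinear_add[OF T, of x y] odd[of y] by simp
  next
    fix c x
    show "T (c *\<^sub>R x) = c *\<^sub>R T x"
    proof (cases "c \<ge> 0")
      case False
      then show ?thesis using sublinear_scale[OF T, of "- c" x] odd[of "c *\<^sub>R x"] by simp
    qed (simp add: sublinear_scale[OF T])
  qed
qed

text \<open>
  A chain of sublinear functionals below \<open>S\<close> is bounded below at \<open>x\<close> by \<open>- S (- x)\<close>; comparability
  of its members makes the pointwise infimum subadditive.
\<close>

lemma sublinear_INF_chain:
  fixes S :: "'a::real_vector \<Rightarrow> real"
  assumes ne: "C \<noteq> {}"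
    and sub: "\<And>T. T \<in> C \<Longrightarrow> sublinear T" and le: "\<And>T x. T \<in> C \<Longrightarrow> T x \<le> S x"
    and chain: "\<And>T T'. T \<in> C \<Longrightarrow> T' \<in> C \<Longrightarrow> T \<le> T' \<or> T' \<le> T"
  shows "sublinear (\<lambda>x. INF T\<in>C. T x)" and "T \<in> C \<Longrightarrow> (INF T\<in>C. T x) \<le> T x"
proof -
  let ?U = "\<lambda>x. INF T\<in>C. T x"
  have "- S (- x) \<le> T x" if "T \<in> C" for T x
    using sublinear_minus_ge[OF sub[OF that], of x] le[OF that, of "- x"] by simp
  then have bdd: "bdd_below ((\<lambda>T. T x) ` C)" for x by (intro bdd_belowI2) auto
  have lower: "?U x \<le> T x" if "T \<in> C" for T x using cINF_lower[OF bdd that] .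
  then show "T \<in> C \<Longrightarrow> (INF T\<in>C. T x) \<le> T x" .
  have zero: "?U 0 = 0"
    using ne sub by (simp add: sublinear_zero cong: INF_cong_simp)
  have scale: "?U (c *\<^sub>R x) = c * ?U x" if "c > 0" for c x
  proof -
    have "?U (c *\<^sub>R x) = (INF T\<in>C. c * T x)"
      using sub that by (intro INF_cong refl sublinear_scale) auto
    also have "\<dots> = c * ?U x"
    proof (rule antisym)
      have "bdd_below ((\<lambda>T. c * T x) ` C)"
        using lower that by (intro bdd_belowI2[where m = "c * ?U x"]) (auto intro: mult_left_mono)
      then have "(INF T\<in>C. c * T x) / c \<le> ?U x"
        using that by (intro cINF_greatest[OF ne])
          (auto simp: divide_le_eq mult.commute[of _ c] intro: cINF_lower)
      then show "(INF T\<in>C. c * T x) \<le> c * ?U x" using that by (simp add: divide_le_eq mult.commute)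
      show "c * ?U x \<le> (INF T\<in>C. c * T x)"
        using that lower by (intro cINF_greatest[OF ne] mult_left_mono) auto
    qed
    finally show ?thesis .
  qed
  have add: "?U (x + y) \<le> ?U x + ?U y" for x y
  proof -
    have pair: "?U (x + y) \<le> T x + T' y" if T: "T \<in> C" "T' \<in> C" for T T'
    proof -
      obtain R where R: "R \<in> C" "R \<le> T" "R \<le> T'" using chain[OF T] T by blast
      have "?U (x + y) \<le> R x + R y"
        using lower[OF R(1), of "x + y"] sublinear_add[OF sub[OF R(1)], of x y] by simp
      then show ?thesis using le_funD[OF R(2), of x] le_funD[OF R(3), of y] by simp
    qed
    have "?U (x + y) - ?U y \<le> ?U x"
    proof (rule cINF_greatest[OF ne])
      fix T assume "T \<in> C"
      have "?U (x + y) - T x \<le> ?U y"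
      proof (rule cINF_greatest[OF ne])
        fix T' assume "T' \<in> C"
        from pair[OF \<open>T \<in> C\<close> this] show "?U (x + y) - T x \<le> T' y" by simp
      qed
      then show "?U (x + y) - ?U y \<le> T x" by simp
    qed
    then show ?thesis by simp
  qed
  show "sublinear ?U" unfolding sublinear_def using zero scale add by blast
qed

theorem exists_linear_le_sublinear:
  fixes S :: "'a::real_vector \<Rightarrow> real"
  assumes S: "sublinear S"
  shows "\<exists>L. linear L \<and> (\<forall>x. L x \<le> S x)"
proof -
  define A where "A = {T. sublinear T \<and> T \<le> S}"
  have "\<exists>m\<in>A. \<forall>a\<in>A. m \<ge> a \<longrightarrow> a = m"
  proof (rule predicate_Zorn)
    show "partial_order_on A (relation_of (\<ge>) A)"
      by (rule partial_order_on_relation_ofI) auto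
  next
    fix C assume C: "C \<in> Chains (relation_of (\<ge>) A)"
    show "\<exists>u\<in>A. \<forall>a\<in>C. a \<ge> u"
    proof (cases "C = {}")
      case True
      then show ?thesis using S by (auto simp: A_def)
    next
      case False
      have CA: "C \<subseteq> A" by (rule Chains_relation_of[OF C])
      have chain: "T \<le> T' \<or> T' \<le> T" if "T \<in> C" "T' \<in> C" for T T'
        using C that by (auto simp: Chains_def relation_of_def)
      have sub: "sublinear T" and le: "T x \<le> S x" if "T \<in> C" for T x
        using CA that by (auto simp: A_def le_fun_def)
      let ?U = "\<lambda>x. INF T\<in>C. T x"
      have sub_U: "sublinear ?U"
        by (rule sublinear_INF_chain(1)[where S = S]) (use False sub le chain in auto)
      have U_le: "?U x \<le> T x" if "T \<in> C" for T x
        by (rule sublinear_INF_chain(2)[where S = S]) (use False sub le chain that in auto)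
      obtain T where T: "T \<in> C" using False by blast
      have "?U \<le> S" using order_trans[OF U_le[OF T] le[OF T]] by (simp add: le_fun_def)
      then have "?U \<in> A" using sub_U by (simp add: A_def)
      moreover have "?U \<le> T" if "T \<in> C" for T using U_le[OF that] by (simp add: le_fun_def)
      ultimately show ?thesis by blast
    qed
  qed
  then obtain T where T: "T \<in> A" and minimal: "\<And>T'. T' \<in> A \<Longrightarrow> T' \<le> T \<Longrightarrow> T' = T" by blast
  have "linear T"
  proof (rule minimal_sublinear_imp_linear)
    show "sublinear T" using T by (simp add: A_def)
    fix T' assume "sublinear T'" "\<And>x. T' x \<le> T x"
    then show "T' = T" using T by (intro minimal) (auto simp: A_def le_fun_def intro: order_trans)
  qed
  then show ?thesis using T by (auto simp: A_def le_fun_def)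
qed

section \<open>Preserving the infimum\<close>

theorem corollary5p3:
  fixes S :: "'a::real_vector \<Rightarrow> real"
    and Z :: "'z set"
    and j :: "'z \<Rightarrow> 'a"
    and k :: "'z \<Rightarrow> real"
  assumes "sublinear S"
    and "Z \<noteq> {}"
    and "\<And>z1 z2. z1 \<in> Z \<Longrightarrow> z2 \<in> Z \<Longrightarrow>
      \<exists>z\<in>Z. S (j z - (1/2) *\<^sub>R j z1 - (1/2) *\<^sub>R j z2)
             + k z - (1/2) * k z1 - (1/2) * k z2 \<le> 0"
  shows "\<exists>L :: 'a \<Rightarrow> real. linear L \<and> (\<forall>x. L x \<le> S x) \<and>
    (INF z\<in>Z. ereal (L (j z) + k z)) = (INF z\<in>Z. ereal (S (j z) + k z))"
proof -
  let ?\<beta> = "INF z\<in>Z. ereal (S (j z) + k z)"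
  have mono: "(INF z\<in>Z. ereal (L (j z) + k z)) \<le> ?\<beta>" if "\<forall>x. L x \<le> S x" for L
    using that by (intro INF_mono') simp
  show ?thesis
  proof (cases ?\<beta>)
    case PInf
    \<comment> \<open>Impossible, as \<open>Z\<close> is nonempty.\<close>
    obtain z where "z \<in> Z" using assms(2) by blast
    from INF_lower[OF this, of "\<lambda>z. ereal (S (j z) + k z)"] PInf show ?thesis by simp
  next
    case MInf
    obtain L where L: "linear L" "\<forall>x. L x \<le> S x"
      using exists_linear_le_sublinear[OF assms(1)] by blast
    then show ?thesis using mono[OF L(2)] MInf by auto
  next
    case (real b)
    have pos: "S (j z) + (k z - b) \<ge> 0" if "z \<in> Z" for z
      using INF_lower[OF that, of "\<lambda>z. ereal (S (j z) + k z)"] real by simp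
    have mid: "\<exists>z\<in>Z. S (j z - (1/2) *\<^sub>R j z1 - (1/2) *\<^sub>R j z2)
        + (k z - b) - (1/2) * (k z1 - b) - (1/2) * (k z2 - b) \<le> 0" if "z1 \<in> Z" "z2 \<in> Z" for z1 z2
      using assms(3)[OF that] by (simp add: field_simps)
    obtain T where T: "sublinear T" "\<forall>x. T x \<le> S x" "\<forall>z\<in>Z. T (- j z) \<le> k z - b"
      using exists_sublinear_minorant[where k = "\<lambda>z. k z - b", OF assms(1,2) mid pos] by blast
    obtain L where L: "linear L" "\<forall>x. L x \<le> T x"
      using exists_linear_le_sublinear[OF T(1)] by blast
    have le: "\<forall>x. L x \<le> S x" using L(2) T(2) order_trans by blast
    have "b \<le> L (j z) + k z" if "z \<in> Z" for z
    proof -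
      have "- L (j z) \<le> k z - b"
        using L(2) T(3) that linear_neg[OF L(1), of "j z"] by (metis order_trans)
      then show ?thesis by simp
    qed
    then have "?\<beta> \<le> (INF z\<in>Z. ereal (L (j z) + k z))"
      unfolding real by (intro INF_greatest) simp
    then show ?thesis using L(1) le mono[OF le] by (intro exI[of _ L]) (simp add: antisym)
  qed
qed

end
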